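(* Fix $\alpha\in(0,1)$, an integer $n\geq 1$, and a model class $\mathcal{F}$. Let $\hat{L}_\alpha(\mathcal{F},\cdot)$ be a valid distribution-free lower bound on the model class risk. Let $P$ be any probability distribution on $\mathcal{Z}$, let $Z_1,Z_2,\dots$ be i.i.d. draws from $P$, and write $\mathcal{D}_k=(Z_1,\dots,Z_k)$ for every $k\geq 1$. Then, for all integers $N\geq n$, $$\mathbb{P}_P\left\{\hat{L}_\alpha(\mathcal{F},\mathcal{D}_n)>\hat{R}(\mathcal{F},\mathcal{D}_N)\right\}\leq \alpha+\frac{n^2}{2N}.$$
   Context: Let $\mathcal{Z}$ be the (measurable) data space, $\mathcal{F}$ a set of models (the model class), and $\ell:\mathcal{F}\times\mathcal{Z}\to[0,\infty)$ a loss function. For a probability distribution $P$ on $\mathcal{Z}$ the risk of $f\in\mathcal{F}$ is $R_P(f)=\mathbb{E}_P[\ell(f,Z)]$ with $Z\sim P$, and the model class risk is $R_P(\mathcal{F})=\inf_{f\in\mathcal{F}}R_P(f)$. For a data set $\mathcal{D}_k=(Z_1,\dots,Z_k)\in\mathcal{Z}^k$, the empirical risk is $\hat{R}(f,\mathcal{D}_k)=\frac1k\sum_{i=1}^k\ell(f,Z_i)$ and $\hat{R}(\mathcal{F},\mathcal{D}_k)=\inf_{f\in\mathcal{F}}\hat{R}(f,\mathcal{D}_k)$. A map $\hat{L}_\alpha(\mathcal{F},\cdot):\mathcal{Z}^n\to[0,\infty]$ is a valid distribution-free lower bound on the model class risk of $\mathcal{F}$ if $\mathbb{P}_P\{R_P(\mathcal{F})\geq\hat{L}_\alpha(\mathcal{F},\mathcal{D}_n)\}\geq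 1-\alpha$ for all distributions $P$ on $\mathcal{Z}$, where $\mathcal{D}_n\sim P^n$. The bound may also be randomized: $\hat{L}_\alpha(\mathcal{F},\mathcal{D}_n,\xi)$ may depend on an independent seed $\xi\sim\mathrm{Unif}[0,1]$, in which case all probabilities are also over $\xi$; the seed is suppressed in the notation. All functions, infima and events involved are implicitly assumed measurable so that expectations and probabilities are defined. *)

theory Defs
  imports "HOL-Probability.Probability"
begin

text \<open>The data space is a measurable space \<open>M\<close>; only its carrier and \<open>\<sigma>\<close>-algebra are used.
  Risks are \<^typ>\<open>ennreal\<close>-valued, because the expectation of a nonnegative loss may be infinite.
  The infimum over an empty class of models is \<open>\<infinity>\<close>.\<close>

definition distributions_on :: "'z measure \<Rightarrow> 'z measure set" where
  "distributions_on M = {P. prob_space P \<and> sets P = sets M}"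

definition risk :: "('f \<Rightarrow> 'z \<Rightarrow> real) \<Rightarrow> 'z measure \<Rightarrow> 'f \<Rightarrow> ennreal" where
  "risk l P f = (\<integral>\<^sup>+ z. ennreal (l f z) \<partial>P)"

definition class_risk :: "('f \<Rightarrow> 'z \<Rightarrow> real) \<Rightarrow> 'z measure \<Rightarrow> 'f set \<Rightarrow> ennreal" where
  "class_risk l P F = (INF f\<in>F. risk l P f)"

text \<open>A data set of size \<open>k\<close> is a function on the index set \<open>{1..k}\<close>, that is, an element of
  \<open>space (PiM {1..k} (\<lambda>_. M))\<close>.\<close>

definition emp_risk :: "('f \<Rightarrow> 'z \<Rightarrow> real) \<Rightarrow> nat \<Rightarrow> (nat \<Rightarrow> 'z) \<Rightarrow> 'f \<Rightarrow> real" where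
  "emp_risk l k D f = (1 / real k) * (\<Sum>i=1..k. l f (D i))"

definition emp_class_risk :: "('f \<Rightarrow> 'z \<Rightarrow> real) \<Rightarrow> nat \<Rightarrow> (nat \<Rightarrow> 'z) \<Rightarrow> 'f set \<Rightarrow> ennreal" where
  "emp_class_risk l k D F = (INF f\<in>F. ennreal (emp_risk l k D f))"

definition valid_lower_bound ::
  "'z measure \<Rightarrow> ('f \<Rightarrow> 'z \<Rightarrow> real) \<Rightarrow> 'f set \<Rightarrow> nat \<Rightarrow> real \<Rightarrow> ((nat \<Rightarrow> 'z) \<Rightarrow> ennreal) \<Rightarrow> bool" where
  "valid_lower_bound M l F n \<alpha> L \<longleftrightarrow>
     L \<in> borel_measurable (PiM {1..n} (\<lambda>_. M)) \<and>
     (\<forall>P \<in> distributions_on M.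
        measure (PiM {1..n} (\<lambda>_. P))
          {D \<in> space (PiM {1..n} (\<lambda>_. P)). class_risk l P F \<ge> L D} \<ge> 1 - \<alpha>)"

definition seed_dist :: "real measure" where
  "seed_dist = uniform_measure lborel {0..1}"

definition valid_randomized_lower_bound ::
  "'z measure \<Rightarrow> ('f \<Rightarrow> 'z \<Rightarrow> real) \<Rightarrow> 'f set \<Rightarrow> nat \<Rightarrow> real \<Rightarrow>
    ((nat \<Rightarrow> 'z) \<Rightarrow> real \<Rightarrow> ennreal) \<Rightarrow> bool" where
  "valid_randomized_lower_bound M l F n \<alpha> L \<longleftrightarrow>
     (\<lambda>(D, u). L D u) \<in> borel_measurable (PiM {1..n} (\<lambda>_. M) \<Otimes>\<^sub>M borel) \<and>
     (\<forall>P \<in> distributions_on M.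
        measure (PiM {1..n} (\<lambda>_. P) \<Otimes>\<^sub>M seed_dist)
          {(D, u) \<in> space (PiM {1..n} (\<lambda>_. P) \<Otimes>\<^sub>M seed_dist).
             class_risk l P F \<ge> L D u} \<ge> 1 - \<alpha>)"

definition iid_draws ::
  "'w measure \<Rightarrow> 'z measure \<Rightarrow> 'z measure \<Rightarrow> (nat \<Rightarrow> 'w \<Rightarrow> 'z) \<Rightarrow> bool" where
  "iid_draws \<Omega> M P Z \<longleftrightarrow>
     prob_space.indep_vars \<Omega> (\<lambda>_. M) Z {1..} \<and> (\<forall>i\<ge>1. distr \<Omega> M (Z i) = P)"

text \<open>The seed is independent of the whole sequence of draws, not merely of each single draw.
  Independence is stated for the generated \<open>\<sigma>\<close>-algebras, since \<^term>\<open>prob_space.indep_var\<close> requires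
  both variables to have the same value type.\<close>

definition independent_seed ::
  "'w measure \<Rightarrow> 'z measure \<Rightarrow> (nat \<Rightarrow> 'w \<Rightarrow> 'z) \<Rightarrow> ('w \<Rightarrow> real) \<Rightarrow> bool" where
  "independent_seed \<Omega> M Z \<xi> \<longleftrightarrow>
     \<xi> \<in> borel_measurable \<Omega> \<and> distr \<Omega> borel \<xi> = seed_dist \<and>
     prob_space.indep_set \<Omega>
       (sets (vimage_algebra (space \<Omega>) (\<lambda>w. \<lambda>i\<in>{1..}. Z i w) (PiM {1..} (\<lambda>_. M))))
       (sets (vimage_algebra (space \<Omega>) \<xi> borel))"

definition data_set :: "(nat \<Rightarrow> 'w \<Rightarrow> 'z) \<Rightarrow> nat \<Rightarrow> 'w \<Rightarrow> nat \<Rightarrow> 'z" where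
  "data_set Z k w = (\<lambda>i\<in>{1..k}. Z i w)"

end

theory Submission
  imports Defs
begin

text \<open>
  The idea is to feed the lower bound a distribution whose class risk is exactly the empirical class
  risk of the large sample. Given a sample \<open>x\<close> of size \<open>N\<close>, its empirical measure is itself a
  distribution on the data space, and each model's risk under it is the average loss over \<open>x\<close>
  (\<open>class_risk_empirical_measure\<close>). Validity of the lower bound under this distribution says that, if
  \<open>n\<close> points are drawn from \<open>x\<close> with replacement, the bound computed from them exceeds the empirical
  class risk of \<open>x\<close> with probability at most \<open>\<alpha>\<close>.

  The event of the theorem concerns the first \<open>n\<close> points of \<open>x\<close> instead. By exchangeability of an
  i.i.d. sample, and because the empirical class risk is a symmetric function of the sample, these
  may be replaced by any \<open>n\<close> points with distinct indices (\<open>nn_integral_PiM_resample_inj\<close>), hence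
  by \<open>n\<close> points drawn without replacement. Drawing with replacement repeats an index with
  probability at most \<open>n(n-1)/(2N)\<close>, the birthday bound (\<open>card_inj_funcset_ge\<close>). If \<open>q\<close> is the
  probability of the event and \<open>e\<close> bounds the chance of a repeated index, then
  \<open>(1 - e) q \<le> \<alpha>\<close>, and since \<open>q \<le> 1\<close> this gives \<open>q \<le> \<alpha> + e\<close>
  (\<open>sample_bound_from_resampling_bound\<close>).

  Deterministic and randomized bounds are treated together by describing a bound through a test
  function \<open>h (D, r)\<close> with values in \<open>[0, 1]\<close>: the probability, over the seed if there is one, that the
  bound computed from \<open>D\<close> exceeds the level \<open>r\<close> (\<open>valid_test_at_emp_class_risk\<close>).
\<close>

section \<open>Empirical measures\<close>

definition empirical_measure :: "'z measure \<Rightarrow> 'j set \<Rightarrow> ('j \<Rightarrow> 'z) \<Rightarrow> 'z measure" where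
  "empirical_measure M J x = distr (uniform_count_measure J) M x"

lemma measurable_sample_points:
  assumes "x \<in> space (PiM J (\<lambda>_. M))"
  shows "x \<in> measurable (uniform_count_measure J) M"
  using assms by (auto simp: measurable_def sets_uniform_count_measure space_uniform_count_measure space_PiM)

lemma empirical_measure_in_distributions_on:
  assumes "finite J" "J \<noteq> {}" "x \<in> space (PiM J (\<lambda>_. M))"
  shows "empirical_measure M J x \<in> distributions_on M"
  unfolding empirical_measure_def distributions_on_def
  using prob_space.prob_space_distr[OF prob_space_uniform_count_measure measurable_sample_points] assms
  by simp

lemma nn_integral_uniform_count_measure:
  assumes "finite A"
  shows "(\<integral>\<^sup>+ a. f a \<partial>uniform_count_measure A) = (\<Sum>a\<in>A. ennreal (1 / real (card A)) * f a)"
  using assms by (simp add: uniform_count_measure_def nn_integral_point_measure_finite)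

text \<open>An expectation under the empirical measure is an average over the sample, so the two infima
  range over equal numbers.\<close>

lemma class_risk_empirical_measure:
  assumes "1 \<le> N" and x: "x \<in> space (PiM {1..N} (\<lambda>_. M))"
    and nn: "\<And>f z. f \<in> F \<Longrightarrow> z \<in> space M \<Longrightarrow> 0 \<le> l f z"
    and meas: "\<And>f. f \<in> F \<Longrightarrow> l f \<in> borel_measurable M"
  shows "class_risk l (empirical_measure M {1..N} x) F = emp_class_risk l N x F"
  unfolding class_risk_def emp_class_risk_def
proof (rule INF_cong[OF refl])
  fix f assume f: "f \<in> F"
  have [measurable]: "l f \<in> borel_measurable M" by (rule meas[OF f])
  have pos: "0 \<le> l f (x i)" if "i \<in> {1..N}" for i
    using that x by (intro nn[OF f]) (auto simp: space_PiM)
  have "risk l (empirical_measure M {1..N} x) f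
      = (\<integral>\<^sup>+ i. ennreal (l f (x i)) \<partial>uniform_count_measure {1..N})"
    unfolding risk_def empirical_measure_def
    using measurable_sample_points[OF x] by (subst nn_integral_distr) auto
  also have "\<dots> = (\<Sum>i=1..N. ennreal (1 / real N) * ennreal (l f (x i)))"
    by (subst nn_integral_uniform_count_measure) auto
  also have "\<dots> = ennreal (emp_risk l N x f)"
    unfolding emp_risk_def sum_distrib_left
    using pos by (subst sum_ennreal[symmetric])
      (auto simp: ennreal_mult simp del: times_divide_eq_left intro!: sum.cong)
  finally show "risk l (empirical_measure M {1..N} x) f = ennreal (emp_risk l N x f)" .
qed

section \<open>Resampling with replacement\<close>

lemma sets_PiM_distributions_on:
  "Q \<in> distributions_on M \<Longrightarrow> sets (PiM I (\<lambda>_. Q)) = sets (PiM I (\<lambda>_. M))"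
  by (intro sets_PiM_cong) (simp_all add: distributions_on_def)

text \<open>A choice of indices \<open>g\<close> from \<open>I\<close> to \<open>J\<close> turns a sample \<open>x\<close> indexed by \<open>J\<close> into the resampled
  data set \<open>compose I x g\<close> indexed by \<open>I\<close>. Below it is viewed first as a function of \<open>x\<close>, for the law of
  the sample, and then as a function of \<open>g\<close>, for a uniformly random choice of indices.\<close>

lemma measurable_compose_resample:
  assumes "g \<in> I \<rightarrow> J"
  shows "(\<lambda>x. compose I x g) \<in> measurable (PiM J (\<lambda>_. M)) (PiM I (\<lambda>_. M))"
  unfolding compose_def using assms by (intro measurable_restrict measurable_component_singleton) auto

lemma measurable_compose_sample:
  assumes "x \<in> space (PiM J (\<lambda>_. M))"
  shows "compose I x \<in> measurable (uniform_count_measure (I \<rightarrow>\<^sub>E J)) (PiM I (\<lambda>_. M))"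
  using assms unfolding measurable_def sets_uniform_count_measure space_uniform_count_measure
  by (auto simp: space_PiM compose_def PiE_iff)

text \<open>Independent draws from the empirical measure amount to a uniformly random index function: on a
  rectangle both sides count index functions coordinate by coordinate.\<close>

lemma PiM_empirical_measure:
  assumes fin: "finite I" "finite J" "J \<noteq> {}" and x: "x \<in> space (PiM J (\<lambda>_. M))"
  shows "PiM I (\<lambda>_. empirical_measure M J x)
    = distr (uniform_count_measure (I \<rightarrow>\<^sub>E J)) (PiM I (\<lambda>_. M)) (compose I x)"
proof -
  let ?Q = "empirical_measure M J x"
  have Q: "prob_space ?Q" "sets ?Q = sets M"
    using empirical_measure_in_distributions_on[OF fin(2,3) x] by (auto simp: distributions_on_def)
  interpret prob_space ?Q by fact
  interpret product_sigma_finite "\<lambda>_. ?Q"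
    by (intro product_sigma_finite.intro sigma_finite_measure_axioms)
  note maps = measurable_compose_sample[OF x]
  have "distr (uniform_count_measure (I \<rightarrow>\<^sub>E J)) (PiM I (\<lambda>_. M)) (compose I x)
      = PiM I (\<lambda>_. ?Q)"
  proof (rule PiM_eqI[OF fin(1)])
    show "sets (distr (uniform_count_measure (I \<rightarrow>\<^sub>E J)) (PiM I (\<lambda>_. M)) (compose I x))
      = sets (PiM I (\<lambda>_. ?Q))"
      by (simp add: Q cong: sets_PiM_cong)
    fix A assume "\<And>i. i \<in> I \<Longrightarrow> A i \<in> sets ?Q"
    then have A: "\<And>i. i \<in> I \<Longrightarrow> A i \<in> sets M" using Q by simp
    let ?B = "\<lambda>i. {j \<in> J. x j \<in> A i}"
    have "emeasure (distr (uniform_count_measure (I \<rightarrow>\<^sub>E J)) (PiM I (\<lambda>_. M)) (compose I x)) (Pi\<^sub>E I A)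
       = emeasure (uniform_count_measure (I \<rightarrow>\<^sub>E J)) (compose I x -` Pi\<^sub>E I A \<inter> (I \<rightarrow>\<^sub>E J))"
      using A fin by (subst emeasure_distr[OF maps])
        (auto simp: space_uniform_count_measure intro!: sets_PiM_I_finite)
    also have "compose I x -` Pi\<^sub>E I A \<inter> (I \<rightarrow>\<^sub>E J) = Pi\<^sub>E I ?B"
      by (auto simp: compose_def PiE_iff)
    also have "emeasure (uniform_count_measure (I \<rightarrow>\<^sub>E J)) (Pi\<^sub>E I ?B)
       = ennreal (real (card (Pi\<^sub>E I ?B)) / real (card (I \<rightarrow>\<^sub>E J)))"
      using fin by (subst emeasure_uniform_count_measure) (auto simp: finite_PiE)
    also have "\<dots> = ennreal (\<Prod>i\<in>I. real (card (?B i)) / real (card J))"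
      using fin by (simp add: card_PiE prod_dividef)
    also have "\<dots> = (\<Prod>i\<in>I. ennreal (real (card (?B i)) / real (card J)))"
      by (subst prod_ennreal) auto
    also have "\<dots> = (\<Prod>i\<in>I. emeasure ?Q (A i))"
    proof (rule prod.cong[OF refl])
      fix i assume "i \<in> I"
      have "emeasure ?Q (A i) = emeasure (uniform_count_measure J) (x -` A i \<inter> J)"
        unfolding empirical_measure_def using A[OF \<open>i \<in> I\<close>]
        by (subst emeasure_distr[OF measurable_sample_points[OF x]]) (auto simp: space_uniform_count_measure)
      also have "x -` A i \<inter> J = ?B i" by auto
      also have "emeasure (uniform_count_measure J) (?B i) = ennreal (real (card (?B i)) / real (card J))"
        using fin by (subst emeasure_uniform_count_measure) auto
      finally show "ennreal (real (card (?B i)) / real (card J)) = emeasure ?Q (A i)" by simp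
    qed
    finally show "emeasure (distr (uniform_count_measure (I \<rightarrow>\<^sub>E J)) (PiM I (\<lambda>_. M)) (compose I x)) (Pi\<^sub>E I A)
       = (\<Prod>i\<in>I. emeasure ?Q (A i))" .
  qed
  then show ?thesis by simp
qed

lemma nn_integral_PiM_empirical_measure:
  assumes fin: "finite I" "finite J" "J \<noteq> {}" and x: "x \<in> space (PiM J (\<lambda>_. M))"
    and f: "f \<in> borel_measurable (PiM I (\<lambda>_. M))"
  shows "(\<integral>\<^sup>+ D. f D \<partial>PiM I (\<lambda>_. empirical_measure M J x))
    = (\<Sum>g\<in>I \<rightarrow>\<^sub>E J. ennreal (1 / real (card (I \<rightarrow>\<^sub>E J))) * f (compose I x g))"
proof -
  note maps = measurable_compose_sample[OF x]
  show ?thesis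
    unfolding PiM_empirical_measure[OF fin x]
    using fin by (subst nn_integral_distr[OF maps])
      (simp_all add: f nn_integral_uniform_count_measure finite_PiE)
qed

section \<open>Exchangeability\<close>

text \<open>The complements of \<open>I\<close> and of its image have the same size, so any bijection between them
  completes \<open>g\<close>.\<close>

lemma inj_extends_to_permutation:
  assumes "finite J" "I \<subseteq> J" "inj_on g I" "g ` I \<subseteq> J"
  obtains \<sigma> where "bij_betw \<sigma> J J" "\<And>i. i \<in> I \<Longrightarrow> \<sigma> i = g i"
proof -
  have "card (J - I) = card (J - g ` I)"
    using assms by (simp add: card_Diff_subset finite_subset card_image)
  then obtain h where h: "bij_betw h (J - I) (J - g ` I)"
    using assms finite_same_card_bij[of "J - I" "J - g ` I"] by auto
  define \<sigma> where "\<sigma> i = (if i \<in> I then g i else h i)" for i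
  have "bij_betw \<sigma> I (g ` I)"
    using assms(3) by (auto simp: bij_betw_def \<sigma>_def inj_on_def)
  moreover have "bij_betw \<sigma> (J - I) (J - g ` I)"
    using h by (subst bij_betw_cong[of _ _ h]) (auto simp: \<sigma>_def)
  ultimately have "bij_betw \<sigma> (I \<union> (J - I)) (g ` I \<union> (J - g ` I))"
    by (rule bij_betw_combine) auto
  also have "I \<union> (J - I) = J" using assms(2) by auto
  also have "g ` I \<union> (J - g ` I) = J" using assms(4) by auto
  finally show thesis by (rule that) (simp add: \<sigma>_def)
qed

text \<open>Permuting the coordinates of an i.i.d. sample preserves its law. Applied to a permutation that
  extends \<open>g\<close>, this moves the coordinates \<open>I\<close> to the indices chosen by \<open>g\<close> while the symmetric
  statistic \<open>R\<close> stays in place.\<close>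

lemma nn_integral_PiM_resample_inj:
  fixes P :: "'a measure" and J :: "'b set"
  assumes P: "prob_space P" and fin: "finite J" "I \<subseteq> J" and g: "inj_on g I" "g ` I \<subseteq> J"
    and h[measurable]: "h \<in> borel_measurable (PiM I (\<lambda>_. P) \<Otimes>\<^sub>M N)"
    and R[measurable]: "R \<in> measurable (PiM J (\<lambda>_. P)) N"
    and sym: "\<And>x \<sigma>. bij_betw \<sigma> J J \<Longrightarrow> R (compose J x \<sigma>) = R x"
  shows "(\<integral>\<^sup>+ x. h (compose I x g, R x) \<partial>PiM J (\<lambda>_. P)) = (\<integral>\<^sup>+ x. h (restrict x I, R x) \<partial>PiM J (\<lambda>_. P))"
proof -
  obtain \<sigma> where \<sigma>: "bij_betw \<sigma> J J" "\<And>i. i \<in> I \<Longrightarrow> \<sigma> i = g i"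
    using inj_extends_to_permutation[OF fin g] by blast
  have \<sigma>J: "inj_on \<sigma> J" "\<sigma> \<in> J \<rightarrow> J" using \<sigma>(1) by (auto simp: bij_betw_def)
  have [measurable]: "(\<lambda>x. restrict x I) \<in> measurable (PiM J (\<lambda>_. P)) (PiM I (\<lambda>_. P))"
    by (rule measurable_restrict_subset[OF fin(2)])
  have perm: "distr (PiM J (\<lambda>_. P)) (PiM J (\<lambda>_. P)) (\<lambda>x. compose J x \<sigma>) = PiM J (\<lambda>_. P)"
    unfolding compose_def using distr_PiM_reindex[OF _ \<sigma>J, of "\<lambda>_. P"] P by simp
  have "(\<integral>\<^sup>+ x. h (restrict x I, R x) \<partial>PiM J (\<lambda>_. P))
      = (\<integral>\<^sup>+ x. h (restrict (compose J x \<sigma>) I, R (compose J x \<sigma>)) \<partial>PiM J (\<lambda>_. P))"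
    by (subst perm[symmetric], subst nn_integral_distr[OF measurable_compose_resample[OF \<sigma>J(2)]]) measurable
  also have "\<dots> = (\<integral>\<^sup>+ x. h (compose I x g, R x) \<partial>PiM J (\<lambda>_. P))"
  proof (intro nn_integral_cong)
    fix x :: "'b \<Rightarrow> 'a"
    have "restrict (compose J x \<sigma>) I = compose I x g"
      using fin(2) \<sigma>(2) by (auto simp: compose_def restrict_def fun_eq_iff)
    then show "h (restrict (compose J x \<sigma>) I, R (compose J x \<sigma>)) = h (compose I x g, R x)"
      by (simp only: sym[OF \<sigma>(1)])
  qed
  finally show ?thesis by simp
qed

section \<open>From resampling with replacement to the sample itself\<close>

text \<open>The birthday bound. With \<open>n = card I\<close> and \<open>N = card J\<close>, the proportion of injective functions
  is the product of \<open>1 - i/N\<close> over \<open>i < n\<close>, and such a product is at least one minus the sum of the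
  \<open>i/N\<close>.\<close>

lemma card_inj_funcset_ge:
  assumes "finite I" "finite J" "card I \<le> card J" "J \<noteq> {}"
  shows "real (card (I \<rightarrow>\<^sub>E J)) * (1 - (real (card I))\<^sup>2 / (2 * real (card J)))
     \<le> real (card {g \<in> I \<rightarrow>\<^sub>E J. inj_on g I})"
proof -
  define n N where "n = card I" and "N = card J"
  have N: "0 < N" "n \<le> N" using assms by (auto simp: n_def N_def card_gt_0_iff)
  have "(\<Sum>i=0..<n. real i) \<le> (real n)\<^sup>2 / 2"
    by (induction n) (auto simp: power2_eq_square field_simps)
  then have "1 - (real n)\<^sup>2 / (2 * real N) \<le> 1 - (\<Sum>i=0..<n. real i) / real N"
    using N by (simp add: field_simps)
  also have "\<dots> = 1 - (\<Sum>i=0..<n. real i / real N)"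
    by (simp add: sum_divide_distrib)
  also have "\<dots> \<le> (\<Prod>i=0..<n. 1 - real i / real N)"
    using N by (intro Weierstrass_prod_ineq) auto
  also have "\<dots> = (\<Prod>i=0..<n. real (N - i) / real N)"
    using N by (intro prod.cong) (auto simp: of_nat_diff field_simps)
  also have "\<dots> = (\<Prod>i=0..<n. real (N - i)) / real N ^ n"
    by (simp add: prod_dividef)
  finally have "real N ^ n * (1 - (real n)\<^sup>2 / (2 * real N)) \<le> (\<Prod>i=0..<n. real (N - i))"
    using N by (simp add: field_simps)
  then show ?thesis
    using card_inj_on_subset_funcset[OF assms(1,2) subset_refl] assms(1)
    by (simp add: n_def N_def card_PiE)
qed

text \<open>Integrating the pointwise bound on the resampling average and keeping only the injective index
  functions, each of which contributes the integral \<open>q\<close> of the conclusion, bounds the proportion of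
  injective functions times \<open>q\<close> by \<open>a\<close>. The remaining proportion is at most
  \<open>(card I)^2 / (2 card J)\<close>; since \<open>q \<le> 1\<close>, it costs no more than this amount.\<close>

lemma sample_bound_from_resampling_bound:
  assumes P: "prob_space P" and fin: "finite J" "I \<subseteq> J" "J \<noteq> {}" and a: "0 \<le> a"
    and h[measurable]: "h \<in> borel_measurable (PiM I (\<lambda>_. P) \<Otimes>\<^sub>M N)"
    and h_le: "\<And>y. h y \<le> 1"
    and R[measurable]: "R \<in> measurable (PiM J (\<lambda>_. P)) N"
    and sym: "\<And>x \<sigma>. bij_betw \<sigma> J J \<Longrightarrow> R (compose J x \<sigma>) = R x"
    and resample: "\<And>x. x \<in> space (PiM J (\<lambda>_. P)) \<Longrightarrow>
      (\<Sum>g\<in>I \<rightarrow>\<^sub>E J. ennreal (1 / real (card (I \<rightarrow>\<^sub>E J))) * h (compose I x g, R x)) \<le> ennreal a"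
  shows "(\<integral>\<^sup>+ x. h (restrict x I, R x) \<partial>PiM J (\<lambda>_. P))
    \<le> ennreal (a + (real (card I))\<^sup>2 / (2 * real (card J)))"
proof -
  let ?\<mu> = "PiM J (\<lambda>_. P)"
  let ?E = "{g \<in> I \<rightarrow>\<^sub>E J. inj_on g I}"
  define p where "p = (\<integral>\<^sup>+ x. h (restrict x I, R x) \<partial>?\<mu>)"
  define C where "C = real (card (I \<rightarrow>\<^sub>E J))"
  define e where "e = (real (card I))\<^sup>2 / (2 * real (card J))"
  interpret \<mu>: prob_space ?\<mu> by (rule prob_space_PiM) (rule P)
  have finI: "finite I" using fin finite_subset by auto
  have finE: "finite (I \<rightarrow>\<^sub>E J)" using finI fin by (auto intro: finite_PiE)
  have C: "C > 0" using fin finI by (simp add: C_def card_PiE card_gt_0_iff)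
  have "p \<le> (\<integral>\<^sup>+ x. 1 \<partial>?\<mu>)" unfolding p_def by (intro nn_integral_mono h_le)
  then have p1: "p \<le> 1" by (simp add: \<mu>.emeasure_space_1)
  then obtain q where q: "p = ennreal q" "0 \<le> q" "q \<le> 1"
    by (cases p) (auto simp: ennreal_le_1 top_unique)
  have meas: "(\<lambda>x. h (compose I x g, R x)) \<in> borel_measurable ?\<mu>" if "g \<in> I \<rightarrow>\<^sub>E J" for g
  proof -
    have [measurable]: "(\<lambda>x. compose I x g) \<in> measurable ?\<mu> (PiM I (\<lambda>_. P))"
      using that by (intro measurable_compose_resample) auto
    show ?thesis by measurable
  qed
  have "ennreal (real (card ?E) / C * q) = (\<Sum>g\<in>?E. ennreal (1 / C) * p)"
    using C q by (simp add: ennreal_of_nat_eq_real_of_nat ennreal_mult[symmetric])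
  also have "\<dots> = (\<Sum>g\<in>?E. ennreal (1 / C) * (\<integral>\<^sup>+ x. h (compose I x g, R x) \<partial>?\<mu>))"
    unfolding p_def
    by (intro sum.cong refl arg_cong2[where f="(*)"] nn_integral_PiM_resample_inj[OF P fin(1,2) _ _ h R sym, symmetric])
       auto
  also have "\<dots> \<le> (\<Sum>g\<in>I \<rightarrow>\<^sub>E J. ennreal (1 / C) * (\<integral>\<^sup>+ x. h (compose I x g, R x) \<partial>?\<mu>))"
    using finE by (intro sum_mono2) auto
  also have "\<dots> = (\<Sum>g\<in>I \<rightarrow>\<^sub>E J. (\<integral>\<^sup>+ x. ennreal (1 / C) * h (compose I x g, R x) \<partial>?\<mu>))"
    using meas by (intro sum.cong refl nn_integral_cmult[symmetric]) auto
  also have "\<dots> = (\<integral>\<^sup>+ x. (\<Sum>g\<in>I \<rightarrow>\<^sub>E J. ennreal (1 / C) * h (compose I x g, R x)) \<partial>?\<mu>)"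
    using meas by (intro nn_integral_sum[symmetric]) auto
  also have "\<dots> \<le> (\<integral>\<^sup>+ x. ennreal a \<partial>?\<mu>)"
    unfolding C_def by (intro nn_integral_mono resample)
  also have "\<dots> = ennreal a" by (simp add: \<mu>.emeasure_space_1)
  finally have upper: "real (card ?E) / C * q \<le> a" using a by simp
  have "C * (1 - e) \<le> real (card ?E)"
    unfolding C_def e_def using finI fin by (intro card_inj_funcset_ge card_mono) auto
  then have "1 - e \<le> real (card ?E) / C" using C by (simp add: field_simps)
  then have "(1 - e) * q \<le> a" using upper mult_right_mono[OF _ q(2)] by (meson order_trans)
  moreover have "e * q \<le> e" using q by (intro mult_left_le) (auto simp: e_def)
  ultimately have "q \<le> a + e" by (simp add: algebra_simps)
  then show ?thesis using q unfolding p_def[symmetric] e_def[symmetric] by (auto intro: ennreal_leI)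
qed

section \<open>Valid tests of the class risk\<close>

lemma emp_class_risk_permute:
  assumes "bij_betw \<sigma> {1..N} {1..N}"
  shows "emp_class_risk l N (compose {1..N} x \<sigma>) F = emp_class_risk l N x F"
proof -
  have "(\<Sum>i=1..N. l f (compose {1..N} x \<sigma> i)) = (\<Sum>i=1..N. l f (x i))" for f
    using sum.reindex_bij_betw[OF assms, of "\<lambda>i. l f (x i)"] by (simp add: compose_def)
  then show ?thesis by (simp add: emp_class_risk_def emp_risk_def)
qed

text \<open>Think of \<open>h (D, r)\<close> as the probability that a lower bound computed from \<open>D\<close> exceeds \<open>r\<close>. With the
  empirical measure of \<open>x\<close> for \<open>Q\<close>, the level \<open>class_risk l Q F\<close> becomes the empirical class risk of
  \<open>x\<close>, and the validity hypothesis becomes the resampling bound.\<close>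

lemma valid_test_at_emp_class_risk:
  assumes "1 \<le> n" "n \<le> N" "0 \<le> \<alpha>" and P: "P \<in> distributions_on M"
    and nn: "\<And>f z. f \<in> F \<Longrightarrow> z \<in> space M \<Longrightarrow> 0 \<le> l f z"
    and meas: "\<And>f. f \<in> F \<Longrightarrow> l f \<in> borel_measurable M"
    and R: "(\<lambda>D. emp_class_risk l N D F) \<in> borel_measurable (PiM {1..N} (\<lambda>_. M))"
    and h[measurable]: "h \<in> borel_measurable (PiM {1..n} (\<lambda>_. M) \<Otimes>\<^sub>M borel)"
    and h_le: "\<And>y. h y \<le> 1"
    and valid: "\<And>Q. Q \<in> distributions_on M \<Longrightarrow>
      (\<integral>\<^sup>+ D. h (D, class_risk l Q F) \<partial>PiM {1..n} (\<lambda>_. Q)) \<le> ennreal \<alpha>"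
  shows "(\<integral>\<^sup>+ x. h (restrict x {1..n}, emp_class_risk l N x F) \<partial>PiM {1..N} (\<lambda>_. P))
    \<le> ennreal (\<alpha> + (real n)\<^sup>2 / (2 * real N))"
proof -
  have P': "prob_space P" using P by (simp add: distributions_on_def)
  have eqn: "sets (PiM {1..n} (\<lambda>_. P)) = sets (PiM {1..n} (\<lambda>_. M))"
   and eqN: "sets (PiM {1..N} (\<lambda>_. P)) = sets (PiM {1..N} (\<lambda>_. M))"
    using P by (simp_all add: sets_PiM_distributions_on)
  have resample: "(\<Sum>g\<in>{1..n} \<rightarrow>\<^sub>E {1..N}. ennreal (1 / real (card ({1..n} \<rightarrow>\<^sub>E {1..N})))
         * h (compose {1..n} x g, emp_class_risk l N x F)) \<le> ennreal \<alpha>"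
    if "x \<in> space (PiM {1..N} (\<lambda>_. P))" for x
  proof -
    have x: "x \<in> space (PiM {1..N} (\<lambda>_. M))" using that sets_eq_imp_space_eq[OF eqN] by simp
    have fin: "finite {1..n}" "finite {1..N}" "{1..N} \<noteq> {}" using assms(1,2) by auto
    have "1 \<le> N" using assms(1,2) by simp
    have "(\<lambda>D. h (D, emp_class_risk l N x F)) \<in> borel_measurable (PiM {1..n} (\<lambda>_. M))"
      by measurable
    moreover have "class_risk l (empirical_measure M {1..N} x) F = emp_class_risk l N x F"
      by (rule class_risk_empirical_measure[OF \<open>1 \<le> N\<close> x nn meas])
    ultimately show ?thesis
      using valid[OF empirical_measure_in_distributions_on[OF fin(2,3) x]]
      by (simp only: nn_integral_PiM_empirical_measure[OF fin x])
  qed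
  have "(\<integral>\<^sup>+ x. h (restrict x {1..n}, emp_class_risk l N x F) \<partial>PiM {1..N} (\<lambda>_. P))
    \<le> ennreal (\<alpha> + (real (card {1..n}))\<^sup>2 / (2 * real (card {1..N})))"
  proof (rule sample_bound_from_resampling_bound[OF P' _ _ _ \<open>0 \<le> \<alpha>\<close> _ h_le _
        emp_class_risk_permute resample])
    show "h \<in> borel_measurable (PiM {1..n} (\<lambda>_. P) \<Otimes>\<^sub>M borel)"
      using h by (simp only: measurable_cong_sets[OF sets_pair_measure_cong[OF eqn refl] refl])
    show "(\<lambda>x. emp_class_risk l N x F) \<in> borel_measurable (PiM {1..N} (\<lambda>_. P))"
      using R by (simp only: measurable_cong_sets[OF eqN refl])
  qed (use assms(1,2) in auto)
  then show ?thesis by simp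
qed

section \<open>The joint law of the draws and the seed\<close>

lemma restrict_data_set:
  "n \<le> N \<Longrightarrow> restrict (data_set Z N w) {1..n} = data_set Z n w"
  by (auto simp: data_set_def restrict_def fun_eq_iff)

lemma distr_data_set:
  assumes \<Omega>: "prob_space \<Omega>" and iid: "iid_draws \<Omega> M P Z" and "1 \<le> N"
  shows "data_set Z N \<in> measurable \<Omega> (PiM {1..N} (\<lambda>_. M))"
    and "distr \<Omega> (PiM {1..N} (\<lambda>_. M)) (data_set Z N) = PiM {1..N} (\<lambda>_. P)"
proof -
  interpret prob_space \<Omega> by fact
  have ind: "indep_vars (\<lambda>_. M) Z {1..N}" and d: "\<And>i. i \<ge> 1 \<Longrightarrow> distr \<Omega> M (Z i) = P"
    using iid indep_vars_subset[of "\<lambda>_. M" Z "{1..}" "{1..N}"] by (auto simp: iid_draws_def)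
  have rv: "Z i \<in> measurable \<Omega> M" if "i \<in> {1..N}" for i
    using ind that by (auto simp: indep_vars_def)
  have eq: "data_set Z N = (\<lambda>w. \<lambda>i\<in>{1..N}. Z i w)" by (simp add: data_set_def fun_eq_iff)
  show "data_set Z N \<in> measurable \<Omega> (PiM {1..N} (\<lambda>_. M))"
    unfolding eq by (intro measurable_restrict rv)
  have "{1..N} \<noteq> {}" using \<open>1 \<le> N\<close> by simp
  from indep_vars_iff_distr_eq_PiM'[OF this rv] ind
  have "distr \<Omega> (PiM {1..N} (\<lambda>_. M)) (data_set Z N) = PiM {1..N} (\<lambda>i. distr \<Omega> M (Z i))"
    unfolding eq by simp
  also have "\<dots> = PiM {1..N} (\<lambda>_. P)" using d by (intro PiM_cong) auto
  finally show "distr \<Omega> (PiM {1..N} (\<lambda>_. M)) (data_set Z N) = PiM {1..N} (\<lambda>_. P)" .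
qed

lemma prob_space_seed_dist: "prob_space seed_dist"
  unfolding seed_dist_def by (rule prob_space_uniform_measure) auto

lemma sets_seed_dist: "sets seed_dist = sets borel"
  by (simp add: seed_dist_def)

text \<open>The first \<open>N\<close> draws are a measurable function of the whole sequence, so the independence of
  the seed from the sequence passes to them.\<close>

lemma distr_data_set_seed:
  assumes \<Omega>: "prob_space \<Omega>" and iid: "iid_draws \<Omega> M P Z" and "1 \<le> N"
    and seed: "independent_seed \<Omega> M Z \<xi>"
  shows "distr \<Omega> (PiM {1..N} (\<lambda>_. M) \<Otimes>\<^sub>M borel) (\<lambda>w. (data_set Z N w, \<xi> w))
    = PiM {1..N} (\<lambda>_. P) \<Otimes>\<^sub>M seed_dist"
proof -
  interpret prob_space \<Omega> by fact
  note [measurable] = distr_data_set(1)[OF \<Omega> iid \<open>1 \<le> N\<close>]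
  note dP = distr_data_set(2)[OF \<Omega> iid \<open>1 \<le> N\<close>, symmetric]
  have [measurable]: "\<xi> \<in> borel_measurable \<Omega>" and d\<xi>: "seed_dist = distr \<Omega> borel \<xi>"
    using seed by (auto simp: independent_seed_def)
  let ?T = "\<lambda>w. \<lambda>i\<in>{1..}. Z i w"
  let ?V = "vimage_algebra (space \<Omega>) ?T (PiM {1..} (\<lambda>_. M))"
  have rv: "Z i \<in> measurable \<Omega> M" if "i \<in> {1..}" for i
    using iid that by (auto simp: iid_draws_def indep_vars_def)
  have T: "?T \<in> measurable \<Omega> (PiM {1..} (\<lambda>_. M))"
    by (intro measurable_restrict rv)
  have "PiM {1..N} (\<lambda>_. P) \<Otimes>\<^sub>M seed_dist
      = distr \<Omega> (PiM {1..N} (\<lambda>_. M) \<Otimes>\<^sub>M borel) (\<lambda>w. (data_set Z N w, \<xi> w))"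
    unfolding dP d\<xi>
  proof (rule pair_measure_eqI)
    show "sigma_finite_measure (distr \<Omega> (PiM {1..N} (\<lambda>_. M)) (data_set Z N))"
      by (rule prob_space_imp_sigma_finite, rule prob_space_distr) measurable
    show "sigma_finite_measure (distr \<Omega> borel \<xi>)"
      by (rule prob_space_imp_sigma_finite, rule prob_space_distr) measurable
    show "sets (distr \<Omega> (PiM {1..N} (\<lambda>_. M)) (data_set Z N) \<Otimes>\<^sub>M distr \<Omega> borel \<xi>)
      = sets (distr \<Omega> (PiM {1..N} (\<lambda>_. M) \<Otimes>\<^sub>M borel) (\<lambda>w. (data_set Z N w, \<xi> w)))"
      by (simp cong: sets_pair_measure_cong)
    fix A B assume "A \<in> sets (distr \<Omega> (PiM {1..N} (\<lambda>_. M)) (data_set Z N))"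
      "B \<in> sets (distr \<Omega> borel \<xi>)"
    then have A[measurable]: "A \<in> sets (PiM {1..N} (\<lambda>_. M))" and B[measurable]: "B \<in> sets borel"
      by auto
    let ?A = "data_set Z N -` A \<inter> space \<Omega>" and ?B = "\<xi> -` B \<inter> space \<Omega>"
    let ?A' = "(\<lambda>y. restrict y {1..N}) -` A \<inter> space (PiM {1..} (\<lambda>_. M))"
    have "?A' \<in> sets (PiM {1..} (\<lambda>_. M))"
      by (rule measurable_sets[OF measurable_restrict_subset A]) auto
    then have "?T -` ?A' \<inter> space \<Omega> \<in> sets ?V" by (rule in_vimage_algebra)
    also have "?T -` ?A' \<inter> space \<Omega> = ?A"
    proof -
      have "restrict (?T w) {1..N} = data_set Z N w" for w
        by (auto simp: data_set_def restrict_def fun_eq_iff)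
      then show ?thesis using measurable_space[OF T] by auto
    qed
    finally have "prob (?A \<inter> ?B) = prob ?A * prob ?B"
      using seed in_vimage_algebra[OF B, of \<xi> "space \<Omega>"]
      unfolding independent_seed_def by (blast intro: indep_setD)
    moreover have "?A \<in> events" "?B \<in> events" by measurable
    ultimately have "emeasure \<Omega> ?A * emeasure \<Omega> ?B = emeasure \<Omega> (?A \<inter> ?B)"
      by (simp add: emeasure_eq_measure ennreal_mult)
    also have "?A \<inter> ?B = (\<lambda>w. (data_set Z N w, \<xi> w)) -` (A \<times> B) \<inter> space \<Omega>" by auto
    finally show "emeasure (distr \<Omega> (PiM {1..N} (\<lambda>_. M)) (data_set Z N)) A * emeasure (distr \<Omega> borel \<xi>) B
       = emeasure (distr \<Omega> (PiM {1..N} (\<lambda>_. M) \<Otimes>\<^sub>M borel) (\<lambda>w. (data_set Z N w, \<xi> w))) (A \<times> B)"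
      by (simp add: emeasure_distr del: One_nat_def)
  qed
  then show ?thesis by simp
qed

section \<open>Lower bounds as tests\<close>

lemma emeasure_eq_nn_integral_if:
  assumes "{x \<in> space M. Q x} \<in> sets M"
  shows "emeasure M {x \<in> space M. Q x} = (\<integral>\<^sup>+ x. (if Q x then 1 else 0) \<partial>M)"
  by (subst nn_integral_indicator[OF assms, symmetric]) (auto intro!: nn_integral_cong simp: indicator_def)

lemma (in prob_space) nn_integral_exceeds_le:
  fixes f :: "'a \<Rightarrow> ennreal"
  assumes [measurable]: "f \<in> borel_measurable M" and "0 \<le> \<alpha>"
    and cover: "1 - \<alpha> \<le> prob {x \<in> space M. f x \<le> c}"
  shows "(\<integral>\<^sup>+ x. (if c < f x then 1 else 0) \<partial>M) \<le> ennreal \<alpha>"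
proof -
  have "{x \<in> space M. c < f x} = space M - {x \<in> space M. f x \<le> c}" by auto
  then have "prob {x \<in> space M. c < f x} \<le> \<alpha>"
    using cover by (simp add: prob_compl)
  then show ?thesis
    by (subst emeasure_eq_nn_integral_if[symmetric]) (auto simp: emeasure_eq_measure intro: ennreal_leI)
qed

lemma valid_lower_bound_exceeds_emp_class_risk:
  assumes \<Omega>: "prob_space \<Omega>" and iid: "iid_draws \<Omega> M P Z"
    and P: "P \<in> distributions_on M" and n: "1 \<le> n" "n \<le> N" and \<alpha>: "0 \<le> \<alpha>"
    and loss_nonneg: "\<And>f z. f \<in> F \<Longrightarrow> z \<in> space M \<Longrightarrow> 0 \<le> l f z"
    and loss_measurable: "\<And>f. f \<in> F \<Longrightarrow> l f \<in> borel_measurable M"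
    and R[measurable]: "(\<lambda>D. emp_class_risk l N D F) \<in> borel_measurable (PiM {1..N} (\<lambda>_. M))"
    and valid: "valid_lower_bound M l F n \<alpha> L"
  shows "measure \<Omega> {w \<in> space \<Omega>. emp_class_risk l N (data_set Z N w) F < L (data_set Z n w)}
      \<le> \<alpha> + (real n)^2 / (2 * real N)"
proof -
  interpret \<Omega>: prob_space \<Omega> by (rule \<Omega>)
  have N: "1 \<le> N" using n by simp
  note [measurable] = distr_data_set(1)[OF \<Omega> iid N]
  have L[measurable]: "L \<in> borel_measurable (PiM {1..n} (\<lambda>_. M))"
    using valid by (simp add: valid_lower_bound_def)
  have [measurable]: "(\<lambda>x. restrict x {1..n}) \<in> measurable (PiM {1..N} (\<lambda>_. M)) (PiM {1..n} (\<lambda>_. M))"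
    using n by (intro measurable_restrict_subset) auto
  let ?h = "\<lambda>(D, r). if r < L D then 1 else 0 :: ennreal"
  note restrict = restrict_data_set[OF n(2)]
  have [measurable]: "(\<lambda>w. L (data_set Z n w)) \<in> borel_measurable \<Omega>"
    unfolding restrict[symmetric] by measurable
  have "ennreal (measure \<Omega> {w \<in> space \<Omega>. emp_class_risk l N (data_set Z N w) F < L (data_set Z n w)})
      = (\<integral>\<^sup>+ w. ?h (data_set Z n w, emp_class_risk l N (data_set Z N w) F) \<partial>\<Omega>)"
    by (subst \<Omega>.emeasure_eq_measure[symmetric], subst emeasure_eq_nn_integral_if) auto
  also have "\<dots> = (\<integral>\<^sup>+ x. ?h (restrict x {1..n}, emp_class_risk l N x F) \<partial>PiM {1..N} (\<lambda>_. P))"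
    unfolding distr_data_set(2)[OF \<Omega> iid N, symmetric]
    by (subst nn_integral_distr) (auto simp: restrict simp del: One_nat_def)
  also have "\<dots> \<le> ennreal (\<alpha> + (real n)^2 / (2 * real N))"
  proof (rule valid_test_at_emp_class_risk[OF n \<alpha> P loss_nonneg loss_measurable R])
    show "?h \<in> borel_measurable (PiM {1..n} (\<lambda>_. M) \<Otimes>\<^sub>M borel)" by measurable
    fix Q assume Q: "Q \<in> distributions_on M"
    note sets_eq = measurable_cong_sets[OF sets_PiM_distributions_on[OF Q] refl]
    interpret prob_space "PiM {1..n} (\<lambda>_. Q)"
      using Q by (intro prob_space_PiM) (auto simp: distributions_on_def)
    show "(\<integral>\<^sup>+ D. ?h (D, class_risk l Q F) \<partial>PiM {1..n} (\<lambda>_. Q)) \<le> ennreal \<alpha>"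
      unfolding prod.case using valid Q L
      by (intro nn_integral_exceeds_le[OF _ \<alpha>]) (simp_all add: valid_lower_bound_def sets_eq)
  qed (auto split: prod.splits)
  finally show ?thesis
    using \<alpha> by (subst (asm) ennreal_le_iff) auto
qed

lemma valid_randomized_lower_bound_exceeds_emp_class_risk:
  assumes \<Omega>: "prob_space \<Omega>" and iid: "iid_draws \<Omega> M P Z"
    and P: "P \<in> distributions_on M" and n: "1 \<le> n" "n \<le> N" and \<alpha>: "0 \<le> \<alpha>"
    and loss_nonneg: "\<And>f z. f \<in> F \<Longrightarrow> z \<in> space M \<Longrightarrow> 0 \<le> l f z"
    and loss_measurable: "\<And>f. f \<in> F \<Longrightarrow> l f \<in> borel_measurable M"
    and R[measurable]: "(\<lambda>D. emp_class_risk l N D F) \<in> borel_measurable (PiM {1..N} (\<lambda>_. M))"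
    and valid: "valid_randomized_lower_bound M l F n \<alpha> L"
    and seed: "independent_seed \<Omega> M Z \<xi>"
  shows "measure \<Omega> {w \<in> space \<Omega>. emp_class_risk l N (data_set Z N w) F < L (data_set Z n w) (\<xi> w)}
      \<le> \<alpha> + (real n)^2 / (2 * real N)"
proof -
  interpret \<Omega>: prob_space \<Omega> by (rule \<Omega>)
  interpret S: prob_space seed_dist by (rule prob_space_seed_dist)
  note [measurable_cong] = sets_seed_dist
  have N: "1 \<le> N" using n by simp
  note [measurable] = distr_data_set(1)[OF \<Omega> iid N]
  have [measurable]: "\<xi> \<in> borel_measurable \<Omega>"
    using seed by (simp add: independent_seed_def)
  have L: "(\<lambda>(D, u). L D u) \<in> borel_measurable (PiM {1..n} (\<lambda>_. M) \<Otimes>\<^sub>M borel)"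
    using valid by (simp add: valid_randomized_lower_bound_def)
  have [measurable]: "(\<lambda>y. L (f y) (g y)) \<in> borel_measurable A"
    if [measurable]: "f \<in> measurable A (PiM {1..n} (\<lambda>_. M))" "g \<in> borel_measurable A" for A f g
    using measurable_compose[OF measurable_Pair[OF that] L] by simp
  have [measurable]: "(\<lambda>x. restrict x {1..n}) \<in> measurable (PiM {1..N} (\<lambda>_. M)) (PiM {1..n} (\<lambda>_. M))"
    using n by (intro measurable_restrict_subset) auto
  \<comment> \<open>The test averages the indicator of exceedance over the seed alone; \<open>?k\<close> is the indicator before
    averaging, as a function of the whole sample and the seed.\<close>
  let ?h = "\<lambda>(D, r). \<integral>\<^sup>+ u. (if r < L D u then 1 else 0) \<partial>seed_dist"
  let ?k = "\<lambda>(x, u). (if emp_class_risk l N x F < L (restrict x {1..n}) u then 1 else 0) :: ennreal"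
  note restrict = restrict_data_set[OF n(2)]
  have [measurable]: "(\<lambda>w. L (data_set Z n w) (\<xi> w)) \<in> borel_measurable \<Omega>"
    unfolding restrict[symmetric] by measurable
  have P': "sets (PiM {1..N} (\<lambda>_. P)) = sets (PiM {1..N} (\<lambda>_. M))"
    using P by (rule sets_PiM_distributions_on)
  have k: "?k \<in> borel_measurable (PiM {1..N} (\<lambda>_. M) \<Otimes>\<^sub>M borel)"
    by measurable
  have k': "?k \<in> borel_measurable (PiM {1..N} (\<lambda>_. P) \<Otimes>\<^sub>M seed_dist)"
    using k by (simp only: measurable_cong_sets[OF sets_pair_measure_cong[OF P' sets_seed_dist] refl])
  have "ennreal (measure \<Omega> {w \<in> space \<Omega>. emp_class_risk l N (data_set Z N w) F < L (data_set Z n w) (\<xi> w)})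
      = (\<integral>\<^sup>+ w. ?k (data_set Z N w, \<xi> w) \<partial>\<Omega>)"
    by (subst \<Omega>.emeasure_eq_measure[symmetric], subst emeasure_eq_nn_integral_if)
      (auto simp: restrict simp del: One_nat_def)
  also have "\<dots> = (\<integral>\<^sup>+ y. ?k y \<partial>(PiM {1..N} (\<lambda>_. P) \<Otimes>\<^sub>M seed_dist))"
    unfolding distr_data_set_seed[OF \<Omega> iid N seed, symmetric]
    using k by (subst nn_integral_distr) (auto simp del: One_nat_def)
  also have "\<dots> = (\<integral>\<^sup>+ x. ?h (restrict x {1..n}, emp_class_risk l N x F) \<partial>PiM {1..N} (\<lambda>_. P))"
    by (subst S.nn_integral_fst[OF k', symmetric]) simp
  also have "\<dots> \<le> ennreal (\<alpha> + (real n)^2 / (2 * real N))"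
  proof (rule valid_test_at_emp_class_risk[OF n \<alpha> P loss_nonneg loss_measurable R])
    show "?h \<in> borel_measurable (PiM {1..n} (\<lambda>_. M) \<Otimes>\<^sub>M borel)" by measurable
    show "?h y \<le> 1" for y
    proof -
      have "(\<integral>\<^sup>+ u. (if r < L D u then 1 else 0) \<partial>seed_dist) \<le> (\<integral>\<^sup>+ u. 1 \<partial>seed_dist)" for D r
        by (intro nn_integral_mono) auto
      then show ?thesis by (simp add: S.emeasure_space_1 split: prod.split)
    qed
    fix Q assume Q: "Q \<in> distributions_on M"
    note meas_eq = measurable_cong_sets[OF sets_pair_measure_cong[OF sets_PiM_distributions_on[OF Q] sets_seed_dist] refl]
    interpret Qn: prob_space "PiM {1..n} (\<lambda>_. Q)"
      using Q by (intro prob_space_PiM) (auto simp: distributions_on_def)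
    interpret QS: pair_prob_space "PiM {1..n} (\<lambda>_. Q)" seed_dist ..
    let ?c = "class_risk l Q F"
    have LQ: "(\<lambda>(D, u). L D u) \<in> borel_measurable (PiM {1..n} (\<lambda>_. Q) \<Otimes>\<^sub>M seed_dist)"
      using L by (simp add: meas_eq)
    then have "(\<lambda>y. if ?c < (case y of (D, u) \<Rightarrow> L D u) then 1 else 0 :: ennreal)
        \<in> borel_measurable (PiM {1..n} (\<lambda>_. Q) \<Otimes>\<^sub>M seed_dist)"
      by measurable
    from S.nn_integral_fst[OF this]
    have "(\<integral>\<^sup>+ D. ?h (D, ?c) \<partial>PiM {1..n} (\<lambda>_. Q))
      = (\<integral>\<^sup>+ y. (if ?c < (case y of (D, u) \<Rightarrow> L D u) then 1 else 0) \<partial>(PiM {1..n} (\<lambda>_. Q) \<Otimes>\<^sub>M seed_dist))"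
      by simp
    also have "\<dots> \<le> ennreal \<alpha>"
    proof (rule QS.nn_integral_exceeds_le[OF LQ \<alpha>])
      let ?S = "space (PiM {1..n} (\<lambda>_. Q) \<Otimes>\<^sub>M seed_dist)"
      have "1 - \<alpha> \<le> measure (PiM {1..n} (\<lambda>_. Q) \<Otimes>\<^sub>M seed_dist) {(D, u) \<in> ?S. L D u \<le> ?c}"
        using valid Q unfolding valid_randomized_lower_bound_def by blast
      also have "{(D, u) \<in> ?S. L D u \<le> ?c} = {y \<in> ?S. (case y of (D, u) \<Rightarrow> L D u) \<le> ?c}"
        by auto
      finally show "1 - \<alpha> \<le> measure (PiM {1..n} (\<lambda>_. Q) \<Otimes>\<^sub>M seed_dist)
          {y \<in> ?S. (case y of (D, u) \<Rightarrow> L D u) \<le> ?c}" .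
    qed
    finally show "(\<integral>\<^sup>+ D. ?h (D, ?c) \<partial>PiM {1..n} (\<lambda>_. Q)) \<le> ennreal \<alpha>" .
  qed
  finally show ?thesis
    using \<alpha> by (subst (asm) ennreal_le_iff) auto
qed

theorem theorem4:
  fixes M :: "'z measure" and F :: "'f set" and l :: "'f \<Rightarrow> 'z \<Rightarrow> real"
    and \<alpha> :: real and n :: nat
    and P :: "'z measure" and \<Omega> :: "'w measure" and Z :: "nat \<Rightarrow> 'w \<Rightarrow> 'z"
  assumes "0 < \<alpha>" and "\<alpha> < 1" and "n \<ge> 1"
    and loss_nonneg: "\<And>f z. f \<in> F \<Longrightarrow> z \<in> space M \<Longrightarrow> 0 \<le> l f z"
    and loss_measurable: "\<And>f. f \<in> F \<Longrightarrow> l f \<in> borel_measurable M"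
    and emp_class_risk_measurable:
      "\<And>k. k \<ge> 1 \<Longrightarrow> (\<lambda>D. emp_class_risk l k D F) \<in> borel_measurable (PiM {1..k} (\<lambda>_. M))"
    and "P \<in> distributions_on M"
    and "prob_space \<Omega>" and "iid_draws \<Omega> M P Z"
  shows "(\<forall>L. valid_lower_bound M l F n \<alpha> L \<longrightarrow>
            (\<forall>N\<ge>n. measure \<Omega> {w \<in> space \<Omega>.
                L (data_set Z n w) > emp_class_risk l N (data_set Z N w) F}
              \<le> \<alpha> + (real n)^2 / (2 * real N))) \<and>
         (\<forall>L \<xi>. valid_randomized_lower_bound M l F n \<alpha> L \<longrightarrow> independent_seed \<Omega> M Z \<xi> \<longrightarrow>
            (\<forall>N\<ge>n. measure \<Omega> {w \<in> space \<Omega>.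
                L (data_set Z n w) (\<xi> w) > emp_class_risk l N (data_set Z N w) F}
              \<le> \<alpha> + (real n)^2 / (2 * real N)))"
proof -
  have N: "1 \<le> N" if "n \<le> N" for N using that \<open>n \<ge> 1\<close> by simp
  note bounds = valid_lower_bound_exceeds_emp_class_risk valid_randomized_lower_bound_exceeds_emp_class_risk
  note prems = \<open>prob_space \<Omega>\<close> \<open>iid_draws \<Omega> M P Z\<close> \<open>P \<in> distributions_on M\<close> \<open>n \<ge> 1\<close>
  show ?thesis
    by (intro conjI allI impI; rule bounds[OF prems _ less_imp_le[OF \<open>0 < \<alpha>\<close>] loss_nonneg loss_measurable
        emp_class_risk_measurable[OF N]]; assumption)
qed

end
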